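(* Let $\Gamma$ be a countable group, let $A$ be a $\Gamma$-GCA in which every countable family of elements has a join (with respect to the canonical partial order $\le$), and let $\mu$ and $\nu$ be finite measures on $A$. Then $\mu(a)=\nu(a)$ for every $\Gamma$-invariant element $a\in A$ if and only if $\mu$ and $\nu$ are equidecomposable, i.e. there are finite measures $(\mu_\gamma)_{\gamma\in\Gamma}$ on $A$ such that $\mu=\sum_{\gamma}\mu_\gamma$ and $\nu=\sum_\gamma\gamma\mu_\gamma$ (pointwise).
   Context: A generalized cardinal algebra (GCA) is a set $A$ with a partial binary operation $+$, a constant $0$, and a partial $\omega$-ary operation $\sum$ (written $\sum_n a_n=\sum(a_n)_{n\in\mathbb N}$) satisfying the following axioms, where asserting an equality in a conclusion includes asserting that the expressions in it are defined: (i) If $\sum_n a_n$ is defined, then $\sum_n a_n=a_0+\sum_{n\ge1}a_n$. (ii) If $\sum_n(a_n+b_n)$ is defined, then $\sum_n(a_n+b_n)=\sum_n a_n+\sum_n b_n$. (iii) For every $a\in A$, $a+0=0+a=a$. (iv) (Refinement) If $a+b=\sum_n c_n$, then there are $(a_n)_n$ and $(b_n)_n$ in $A$ with $a=\sum_n a_n$, $b=\sum_n b_n$ and $c_n=a_n+b_n$ for all $n$. (v) (Remainder) If $(a_n)_n$ and $(b_n)_n$ satisfy $a_n=b_n+a_{n+1}$ for all $n$, then there is $c\in A$ such that $a_n=c+\sum_{i\ge n}b_i$ for each $n$. The relation $a\le b\iff\exists c\,[a+c=b]$ is a partial order on $A$ with least element $0$; joins are taken with respect to $\le$. A homomorphism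 of GCAs is a map $\phi$ such that $a=b+c$ implies $\phi(a)=\phi(b)+\phi(c)$, $\phi(0)=0$, and $a=\sum_n a_n$ implies $\phi(a)=\sum_n\phi(a_n)$. A $\Gamma$-GCA is a GCA $A$ with a group action of the countable group $\Gamma$ on the set $A$ such that each map $a\mapsto\gamma a$ is a homomorphism. An element $a\in A$ is $\Gamma$-invariant if $\gamma a=a$ for every $\gamma\in\Gamma$. Let $\mathbb R^+=[0,\infty)$, a GCA under usual addition, with $\sum$ defined on the sequences whose series converges. A finite measure on $A$ is a homomorphism $A\to\mathbb R^+$. The group $\Gamma$ acts on finite measures by $(\gamma\mu)(a)=\mu(\gamma^{-1}a)$. *)

theory Defs
  imports
    "HOL-Analysis.Infinite_Sum"
    "HOL-Algebra.Group_Action"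
    "HOL-Algebra.Order"
begin

section \<open>Generalized cardinal algebras\<close>

text \<open>
  The partial operations are option-valued, \<open>None\<close> meaning undefined. Their values on arguments
  outside the carrier are irrelevant: every condition below is relative to the carrier.
\<close>

record 'a gca_struct = "'a partial_object" +
  padd :: "'a \<Rightarrow> 'a \<Rightarrow> 'a option"
  pzero :: 'a
  psum :: "(nat \<Rightarrow> 'a) \<Rightarrow> 'a option"

locale gca =
  fixes A :: "('a, 'm) gca_struct_scheme"
  assumes padd_closed:
      "\<And>a b s. \<lbrakk>a \<in> carrier A; b \<in> carrier A; padd A a b = Some s\<rbrakk> \<Longrightarrow> s \<in> carrier A"
    and pzero_closed: "pzero A \<in> carrier A"
    and psum_closed:
      "\<And>a s. \<lbrakk>range a \<subseteq> carrier A; psum A a = Some s\<rbrakk> \<Longrightarrow> s \<in> carrier A"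
    and psum_shift:
      "\<And>a s. \<lbrakk>range a \<subseteq> carrier A; psum A a = Some s\<rbrakk> \<Longrightarrow>
        \<exists>t. psum A (\<lambda>n. a (Suc n)) = Some t \<and> padd A (a 0) t = Some s"
    and psum_padd:
      "\<And>a b c s. \<lbrakk>range a \<subseteq> carrier A; range b \<subseteq> carrier A;
        \<And>n. padd A (a n) (b n) = Some (c n); psum A c = Some s\<rbrakk> \<Longrightarrow>
        \<exists>u v. psum A a = Some u \<and> psum A b = Some v \<and> padd A u v = Some s"
    and padd_pzero:
      "\<And>a. a \<in> carrier A \<Longrightarrow> padd A a (pzero A) = Some a \<and> padd A (pzero A) a = Some a"
    and refinement:
      "\<And>a b c s. \<lbrakk>a \<in> carrier A; b \<in> carrier A; range c \<subseteq> carrier A;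
        padd A a b = Some s; psum A c = Some s\<rbrakk> \<Longrightarrow>
        \<exists>x y. range x \<subseteq> carrier A \<and> range y \<subseteq> carrier A \<and>
          psum A x = Some a \<and> psum A y = Some b \<and> (\<forall>n. padd A (x n) (y n) = Some (c n))"
    and remainder:
      "\<And>a b. \<lbrakk>range a \<subseteq> carrier A; range b \<subseteq> carrier A;
        \<And>n. padd A (b n) (a (Suc n)) = Some (a n)\<rbrakk> \<Longrightarrow>
        \<exists>c\<in>carrier A. \<forall>n. \<exists>t. psum A (\<lambda>i. b (n + i)) = Some t \<and> padd A c t = Some (a n)"

definition gca_order :: "('a, 'm) gca_struct_scheme \<Rightarrow> 'a gorder" where
  "gca_order A = \<lparr>carrier = carrier A, eq = (=),
     le = (\<lambda>a b. \<exists>c\<in>carrier A. padd A a c = Some b)\<rparr>"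

text \<open>The join of a set \<open>X\<close> is the least element of its set of upper bounds.\<close>

definition has_countable_joins :: "('a, 'm) gca_struct_scheme \<Rightarrow> bool" where
  "has_countable_joins A \<longleftrightarrow>
     (\<forall>X. X \<subseteq> carrier A \<and> countable X \<longrightarrow>
       (\<exists>j. least (gca_order A) j (Upper (gca_order A) X)))"

definition gca_hom ::
  "('a, 'm) gca_struct_scheme \<Rightarrow> ('b, 'n) gca_struct_scheme \<Rightarrow> ('a \<Rightarrow> 'b) \<Rightarrow> bool" where
  "gca_hom A B \<phi> \<longleftrightarrow>
     \<phi> \<in> carrier A \<rightarrow> carrier B \<and>
     (\<forall>b\<in>carrier A. \<forall>c\<in>carrier A. \<forall>a.
        padd A b c = Some a \<longrightarrow> padd B (\<phi> b) (\<phi> c) = Some (\<phi> a)) \<and>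
     \<phi> (pzero A) = pzero B \<and>
     (\<forall>f a. range f \<subseteq> carrier A \<and> psum A f = Some a \<longrightarrow>
        psum B (\<lambda>n. \<phi> (f n)) = Some (\<phi> a))"

locale gamma_gca = gca A + group_action \<Gamma> "carrier A" act
  for \<Gamma> :: "('g, 'k) monoid_scheme" and A :: "('a, 'm) gca_struct_scheme"
    and act :: "'g \<Rightarrow> 'a \<Rightarrow> 'a" +
  assumes countable_group: "countable (carrier \<Gamma>)"
    and act_hom: "\<And>\<gamma>. \<gamma> \<in> carrier \<Gamma> \<Longrightarrow> gca_hom A A (act \<gamma>)"

definition gamma_invariant ::
  "('g, 'k) monoid_scheme \<Rightarrow> ('g \<Rightarrow> 'a \<Rightarrow> 'a) \<Rightarrow> 'a \<Rightarrow> bool" where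
  "gamma_invariant \<Gamma> act a \<longleftrightarrow> (\<forall>\<gamma>\<in>carrier \<Gamma>. act \<gamma> a = a)"


section \<open>Finite measures\<close>

definition nonneg_reals :: "real gca_struct" where
  "nonneg_reals = \<lparr>carrier = {0..}, padd = (\<lambda>x y. Some (x + y)), pzero = 0,
     psum = (\<lambda>f. if summable f then Some (suminf f) else None)\<rparr>"

lemma gca_nonneg_reals: "gca nonneg_reals"
proof
  fix a b c :: "nat \<Rightarrow> real" and s
  assume *: "range a \<subseteq> carrier nonneg_reals" "range b \<subseteq> carrier nonneg_reals"
    "\<And>n. padd nonneg_reals (a n) (b n) = Some (c n)" "psum nonneg_reals c = Some s"
  have c: "c = (\<lambda>n. a n + b n)" and sc: "summable c" and s: "s = suminf c"
    using *(3,4) by (auto simp: nonneg_reals_def split: if_splits)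
  have nn: "\<And>n. 0 \<le> a n" "\<And>n. 0 \<le> b n"
    using *(1,2) by (auto simp: nonneg_reals_def)
  have "summable a" "summable b"
    by (rule summable_comparison_test'[OF sc, of 0]; simp add: c nn)+
  then show "\<exists>u v. psum nonneg_reals a = Some u \<and> psum nonneg_reals b = Some v \<and>
      padd nonneg_reals u v = Some s"
    by (simp add: nonneg_reals_def s c suminf_add)
next
  fix a b s :: real and c :: "nat \<Rightarrow> real"
  assume *: "a \<in> carrier nonneg_reals" "b \<in> carrier nonneg_reals"
    "range c \<subseteq> carrier nonneg_reals" "padd nonneg_reals a b = Some s"
    "psum nonneg_reals c = Some s"
  have ab: "0 \<le> a" "0 \<le> b" "s = a + b" and c: "\<And>n. 0 \<le> c n" "c sums s"
    using * by (auto simp: nonneg_reals_def sums_iff split: if_splits)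
  show "\<exists>x y. range x \<subseteq> carrier nonneg_reals \<and> range y \<subseteq> carrier nonneg_reals \<and>
      psum nonneg_reals x = Some a \<and> psum nonneg_reals y = Some b \<and>
      (\<forall>n. padd nonneg_reals (x n) (y n) = Some (c n))"
  proof (cases "s = 0")
    case True
    then have "\<And>n. c n = 0"
      using c suminf_eq_zero_iff[of c] by (auto simp: sums_iff)
    with True ab show ?thesis
      by (intro exI[of _ "\<lambda>_. 0"]) (auto simp: nonneg_reals_def)
  next
    case False
    have "(\<lambda>n. c n * (a / s)) sums (s * (a / s))" "(\<lambda>n. c n * (b / s)) sums (s * (b / s))"
      using c(2) by (rule sums_mult2)+
    moreover have "c n * (a / s) + c n * (b / s) = c n" for n
      using False ab(3) by (simp flip: distrib_left add_divide_distrib)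
    ultimately show ?thesis
      using False ab c
      by (intro exI[of _ "\<lambda>n. c n * (a / s)"] exI[of _ "\<lambda>n. c n * (b / s)"])
        (auto simp: nonneg_reals_def sums_iff)
  qed
next
  fix a b :: "nat \<Rightarrow> real"
  assume *: "range a \<subseteq> carrier nonneg_reals" "range b \<subseteq> carrier nonneg_reals"
    "\<And>n. padd nonneg_reals (b n) (a (Suc n)) = Some (a n)"
  have nn: "\<And>n. 0 \<le> a n" "\<And>n. 0 \<le> b n" and eq: "\<And>n. b n + a (Suc n) = a n"
    using * by (auto simp: nonneg_reals_def)
  have part: "a 0 = (\<Sum>i<n. b i) + a n" for n
  proof (induction n)
    case (Suc n)
    then show ?case using eq[of n] by simp
  qed simp
  have le: "(\<Sum>i<n. b i) \<le> a 0" for n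
    using part[of n] nn(1)[of n] by simp
  have sb: "summable b"
    by (rule summableI_nonneg_bounded[where x = "a 0"]) (use nn le in auto)
  have "suminf b \<le> a 0"
    using sb le by (rule suminf_le_const)
  moreover have "a 0 - suminf b + (\<Sum>i. b (n + i)) = a n" for n
    using part[of n] suminf_split_initial_segment[OF sb, of n] by (simp add: add.commute)
  moreover have "summable (\<lambda>i. b (n + i))" for n
    using summable_ignore_initial_segment[OF sb, of n] by (simp add: add.commute)
  ultimately show "\<exists>c\<in>carrier nonneg_reals. \<forall>n. \<exists>t. psum nonneg_reals (\<lambda>i. b (n + i)) = Some t \<and>
      padd nonneg_reals c t = Some (a n)"
    by (intro bexI[of _ "a 0 - suminf b"]) (auto simp: nonneg_reals_def)
qed (auto simp: nonneg_reals_def suminf_nonneg image_subset_iff summable_Suc_iff suminf_split_head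
      split: if_splits)

definition finite_measure_on :: "('a, 'm) gca_struct_scheme \<Rightarrow> ('a \<Rightarrow> real) \<Rightarrow> bool" where
  "finite_measure_on A \<mu> \<longleftrightarrow> gca_hom A nonneg_reals \<mu>"

definition act_measure ::
  "('g, 'k) monoid_scheme \<Rightarrow> ('g \<Rightarrow> 'a \<Rightarrow> 'a) \<Rightarrow> 'g \<Rightarrow> ('a \<Rightarrow> real) \<Rightarrow> 'a \<Rightarrow> real" where
  "act_measure \<Gamma> act \<gamma> \<mu> = (\<lambda>a. \<mu> (act (inv\<^bsub>\<Gamma>\<^esub> \<gamma>) a))"

text \<open>All terms are nonnegative, so the unordered sums over \<open>\<Gamma>\<close> are the countable sums in
  \<^term>\<open>nonneg_reals\<close> along any enumeration of the group.\<close>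

definition equidecomposable ::
  "('g, 'k) monoid_scheme \<Rightarrow> ('a, 'm) gca_struct_scheme \<Rightarrow> ('g \<Rightarrow> 'a \<Rightarrow> 'a) \<Rightarrow>
    ('a \<Rightarrow> real) \<Rightarrow> ('a \<Rightarrow> real) \<Rightarrow> bool" where
  "equidecomposable \<Gamma> A act \<mu> \<nu> \<longleftrightarrow>
     (\<exists>m. (\<forall>\<gamma>\<in>carrier \<Gamma>. finite_measure_on A (m \<gamma>)) \<and>
       (\<forall>a\<in>carrier A.
          ((\<lambda>\<gamma>. m \<gamma> a) has_sum \<mu> a) (carrier \<Gamma>) \<and>
          ((\<lambda>\<gamma>. act_measure \<Gamma> act \<gamma> (m \<gamma>) a) has_sum \<nu> a) (carrier \<Gamma>)))"

end

theory Submission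
  imports Defs
begin

text \<open>
  Enumerate the group as \<open>\<gamma>\<^sub>0, \<gamma>\<^sub>1, \<dots>\<close> and match the two measures greedily: at step \<open>n\<close> let
  \<open>m\<^sub>n\<close> be the meet of what is left of \<open>\<mu>\<close> and of the translate by \<open>\<gamma>\<^sub>n\<close> inverse of what is left of \<open>\<nu>\<close>,
  and subtract \<open>m\<^sub>n\<close> from the former and its translate from the latter. The limits \<open>\<pi>\<close> and \<open>\<rho>\<close>
  of the remainders have the property that \<open>\<pi>\<close> is singular to every translate of \<open>\<rho>\<close>, and they still
  agree on invariant elements. If \<open>\<pi> x > 0\<close>, a Borel--Cantelli argument gives an element below \<open>x\<close>
  of positive \<open>\<pi>\<close>-measure with \<open>\<rho>\<close>-null orbit; the join of its orbit is invariant, \<open>\<rho>\<close>-null and not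
  \<open>\<pi>\<close>-null, a contradiction. Hence \<open>\<pi> = 0\<close>, and \<open>\<rho> = 0\<close> by looking at joins of orbits.
\<close>

section \<open>Arithmetic in generalized cardinal algebras\<close>

context gca
begin

abbreviation below :: "'a \<Rightarrow> 'a \<Rightarrow> bool" (infix "\<preceq>" 50)
  where "a \<preceq> b \<equiv> \<exists>c\<in>carrier A. padd A a c = Some b"

abbreviation zeros :: "nat \<Rightarrow> 'a"
  where "zeros \<equiv> \<lambda>_. pzero A"

lemma range_case_nat:
  "a \<in> carrier A \<Longrightarrow> range f \<subseteq> carrier A \<Longrightarrow> range (case_nat a f) \<subseteq> carrier A"
  by (auto simp: image_subset_iff split: nat.splits)

lemma range_zeros: "range zeros \<subseteq> carrier A"
  using pzero_closed by auto

lemma padd_zero_right [simp]: "a \<in> carrier A \<Longrightarrow> padd A a (pzero A) = Some a"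
  and padd_zero_left [simp]: "a \<in> carrier A \<Longrightarrow> padd A (pzero A) a = Some a"
  using padd_pzero by auto

section \<open>Heads and tails of countable sums\<close>

lemma psum_tails:
  assumes f: "range f \<subseteq> carrier A" and s: "psum A f = Some s"
  obtains t where "range t \<subseteq> carrier A" "t 0 = s" "\<And>n. psum A (\<lambda>i. f (n + i)) = Some (t n)"
    "\<And>n. padd A (f n) (t (Suc n)) = Some (t n)"
proof -
  have ex: "\<exists>t. psum A (\<lambda>i. f (n + i)) = Some t" for n
  proof (induction n)
    case (Suc n)
    then obtain t where "psum A (\<lambda>i. f (n + i)) = Some t" by blast
    then show ?case
      using psum_shift[of "\<lambda>i. f (n + i)" t] f by (auto simp: image_subset_iff)
  qed (use s in simp)
  define t where "t n = the (psum A (\<lambda>i. f (n + i)))" for n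
  have t: "psum A (\<lambda>i. f (n + i)) = Some (t n)" for n
    using ex[of n] by (auto simp: t_def)
  have step: "padd A (f n) (t (Suc n)) = Some (t n)" for n
    using psum_shift[OF _ t[of n]] t[of "Suc n"] f by (auto simp: image_subset_iff)
  have "t n \<in> carrier A" for n
    using psum_closed[OF _ t[of n]] f by (auto simp: image_subset_iff)
  moreover have "t 0 = s"
    using t[of 0] s by simp
  ultimately show thesis
    using t step by (intro that[of t]) (simp_all add: image_subset_iff)
qed

text \<open>The remainder axiom is used only to see that the left-hand side is defined.\<close>

lemma psum_case_nat:
  assumes a: "a \<in> carrier A" and f: "range f \<subseteq> carrier A"
    and t: "psum A f = Some t" and s: "padd A a t = Some s"
  shows "psum A (case_nat a f) = Some s"
proof -
  obtain u where u: "range u \<subseteq> carrier A" "u 0 = t"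
    "\<And>n. padd A (f n) (u (Suc n)) = Some (u n)"
    using psum_tails[OF f t] by metis
  have sc: "s \<in> carrier A"
    using padd_closed[OF a _ s] u(1,2) by blast
  have "padd A (case_nat a f n) (case_nat s u (Suc n)) = Some (case_nat s u n)" for n
    using u s by (auto split: nat.split)
  then have "\<exists>v. psum A (\<lambda>i. case_nat a f (0 + i)) = Some v"
    using remainder[of "case_nat s u" "case_nat a f"] range_case_nat[OF a f]
      range_case_nat[OF sc u(1)] by blast
  then obtain v where "psum A (case_nat a f) = Some v"
    by auto
  then show ?thesis
    using psum_shift[of "case_nat a f" v] range_case_nat[OF a f] t s by simp
qed

text \<open>Remainder alone gives only \<open>c + z = 0\<close>, where \<open>z\<close> is the sum
  of zeros. Then \<open>c, 0, 0, ...\<close> also sums to 0, and splitting each of its terms as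
  itself plus 0 turns this value into \<open>0 + z\<close>, which is \<open>z\<close>.\<close>

lemma psum_zeros [simp]: "psum A zeros = Some (pzero A)"
proof -
  obtain c z where c: "c \<in> carrier A" and z: "psum A zeros = Some z"
    and cz: "padd A c z = Some (pzero A)"
    using remainder[of zeros zeros] pzero_closed by auto
  have zc: "z \<in> carrier A"
    using psum_closed[OF range_zeros z] .
  have c0: "psum A (case_nat c zeros) = Some (pzero A)"
    by (rule psum_case_nat[OF c range_zeros z cz])
  have "padd A (case_nat c zeros n) (zeros n) = Some (case_nat c zeros n)" for n
    using c pzero_closed by (auto split: nat.split)
  then obtain u v where "psum A (case_nat c zeros) = Some u" "psum A zeros = Some v"
      "padd A u v = Some (pzero A)"
    using psum_padd[OF range_case_nat[OF c range_zeros] range_zeros _ c0] by blast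
  then show ?thesis
    using c0 z zc by (metis option.inject padd_zero_left)
qed

section \<open>Binary sums as countable sums padded with zeros\<close>

lemma psum_pair_iff:
  assumes "a \<in> carrier A" "b \<in> carrier A"
  shows "psum A (case_nat a (case_nat b zeros)) = Some s \<longleftrightarrow> padd A a b = Some s"
proof -
  have b: "psum A (case_nat b zeros) = Some b"
    by (rule psum_case_nat) (use assms pzero_closed in auto)
  show ?thesis
  proof
    assume "psum A (case_nat a (case_nat b zeros)) = Some s"
    from psum_shift[OF _ this] show "padd A a b = Some s"
      using b range_case_nat[OF assms(1) range_case_nat[OF assms(2) range_zeros]] by simp
  qed (rule psum_case_nat[OF assms(1) range_case_nat[OF assms(2) range_zeros] b])
qed

text \<open>Termwise additivity of countable sums, applied to padded pairs. With a two-sided zero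
  this is the setting of the Eckmann-Hilton argument: commutativity and both directions of
  associativity follow by setting some of the four entries to 0.\<close>

lemma padd_interchange:
  assumes c: "a1 \<in> carrier A" "a2 \<in> carrier A" "b1 \<in> carrier A" "b2 \<in> carrier A"
    and "padd A a1 a2 = Some a" "padd A b1 b2 = Some b" "padd A a b = Some s"
  obtains u v where "padd A a1 b1 = Some u" "padd A a2 b2 = Some v" "padd A u v = Some s"
proof -
  have ab: "a \<in> carrier A" "b \<in> carrier A"
    using assms padd_closed by blast+
  let ?p = "\<lambda>x y. case_nat x (case_nat y zeros)"
  have "padd A (?p a1 b1 n) (?p a2 b2 n) = Some (?p a b n)" for n
    using assms pzero_closed by (auto split: nat.split)
  moreover have "psum A (?p a b) = Some s"
    using psum_pair_iff[OF ab] assms by simp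
  ultimately obtain u v where "psum A (?p a1 b1) = Some u" "psum A (?p a2 b2) = Some v"
      "padd A u v = Some s"
    using psum_padd[of "?p a1 b1" "?p a2 b2" "?p a b" s] range_case_nat range_zeros c by metis
  then show thesis
    using that psum_pair_iff c by simp
qed

lemma padd_commute:
  assumes a: "a \<in> carrier A" and b: "b \<in> carrier A" and s: "padd A a b = Some s"
  shows "padd A b a = Some s"
proof -
  obtain u v where "padd A (pzero A) b = Some u" "padd A a (pzero A) = Some v" "padd A u v = Some s"
    by (rule padd_interchange[OF pzero_closed a b pzero_closed padd_zero_left[OF a]
          padd_zero_right[OF b] s])
  then show ?thesis
    using padd_zero_left[OF b] padd_zero_right[OF a] by simp
qed

lemma padd_assoc:
  assumes a: "a \<in> carrier A" and b: "b \<in> carrier A" and c: "c \<in> carrier A"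
    and t: "padd A b c = Some t" and s: "padd A a t = Some s"
  obtains u where "padd A a b = Some u" "padd A u c = Some s"
proof -
  obtain u v where "padd A a b = Some u" "padd A (pzero A) c = Some v" "padd A u v = Some s"
    by (rule padd_interchange[OF a pzero_closed b c padd_zero_right[OF a] t s])
  then show thesis
    using that padd_zero_left[OF c] by simp
qed

lemma padd_assoc':
  assumes a: "a \<in> carrier A" and b: "b \<in> carrier A" and c: "c \<in> carrier A"
    and t: "padd A a b = Some t" and s: "padd A t c = Some s"
  obtains u where "padd A b c = Some u" "padd A a u = Some s"
proof -
  obtain u v where "padd A a (pzero A) = Some u" "padd A b c = Some v" "padd A u v = Some s"
    by (rule padd_interchange[OF a b pzero_closed c t padd_zero_left[OF c] s])
  then show thesis
    using that padd_zero_right[OF a] by simp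
qed

section \<open>The canonical order and binary refinement\<close>

lemma below_trans:
  assumes a: "a \<in> carrier A" and "b \<preceq> c" "a \<preceq> b"
  shows "a \<preceq> c"
proof -
  obtain x y where x: "x \<in> carrier A" "padd A a x = Some b"
    and y: "y \<in> carrier A" "padd A b y = Some c"
    using assms(2,3) by blast
  obtain u where "padd A x y = Some u" "padd A a u = Some c"
    by (rule padd_assoc'[OF a x(1) y(1) x(2) y(2)])
  with padd_closed[OF x(1) y(1)] show ?thesis by blast
qed

text \<open>Remainder applied to \<open>a, b, a, b, \<dots>\<close> gives \<open>a = c + (y + x + y + \<dots>)\<close> and
  \<open>b = c + (x + y + x + \<dots>)\<close>, and the two alternating sums agree.\<close>

lemma below_antisym:
  assumes a: "a \<in> carrier A" and b: "b \<in> carrier A" and "a \<preceq> b" "b \<preceq> a"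
  shows "a = b"
proof -
  obtain x y where x: "x \<in> carrier A" "padd A x a = Some b"
    and y: "y \<in> carrier A" "padd A y b = Some a"
    using assms padd_commute by blast
  define p q X Y where "p n = (if even n then a else b)" and "q n = (if even n then y else x)"
    and "X n = (if even n then pzero A else x)" and "Y n = (if even n then y else pzero A)"
    for n :: nat
  have ranges: "range p \<subseteq> carrier A" "range q \<subseteq> carrier A" "range X \<subseteq> carrier A"
    "range Y \<subseteq> carrier A" "range (\<lambda>n. X (Suc n)) \<subseteq> carrier A" "range (\<lambda>n. Y (Suc n)) \<subseteq> carrier A"
    using a b x y pzero_closed by (auto simp: p_def q_def X_def Y_def)
  have "padd A (q n) (p (Suc n)) = Some (p n)" for n
    using x y by (simp add: p_def q_def)
  then obtain c where c: "\<And>n. \<exists>t. psum A (\<lambda>i. q (n + i)) = Some t \<and> padd A c t = Some (p n)"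
    using remainder[OF ranges(1,2)] by blast
  obtain t0 where t0: "psum A q = Some t0" "padd A c t0 = Some a"
    using c[of 0] by (auto simp: p_def)
  obtain t1 where t1: "psum A (\<lambda>i. q (Suc i)) = Some t1" "padd A c t1 = Some b"
    using c[of 1] by (auto simp: p_def)
  have "padd A (Y n) (X n) = Some (q n)" "padd A (X (Suc n)) (Y (Suc n)) = Some (q (Suc n))" for n
    using x y by (auto simp: X_def Y_def q_def)
  then obtain u v u' v' where uv: "psum A Y = Some u" "psum A X = Some v" "padd A u v = Some t0"
    "psum A (\<lambda>n. X (Suc n)) = Some v'" "psum A (\<lambda>n. Y (Suc n)) = Some u'" "padd A v' u' = Some t1"
    using psum_padd[OF ranges(4,3) _ t0(1)] psum_padd[OF ranges(5,6) _ t1(1)] by blast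
  have cl: "u \<in> carrier A" "v \<in> carrier A" "u' \<in> carrier A" "v' \<in> carrier A"
    using psum_closed uv ranges by blast+
  \<comment> \<open>Dropping a leading zero does not change a sum. \<open>X\<close> starts with one,
    so its sum equals that of its shift; the shift of \<open>Y\<close> starts with one as well, and
    a second shift brings back \<open>Y\<close>.\<close>
  have Y_shift: "(\<lambda>n. Y (Suc (Suc n))) = Y" "Y (Suc 0) = pzero A"
    by (auto simp: Y_def)
  have "v' = v"
    using psum_shift[OF ranges(3) uv(2)] uv(4) cl by (simp add: X_def)
  moreover have "u' = u"
    using psum_shift[OF ranges(6) uv(5)] uv(1) cl Y_shift by simp
  ultimately have "t0 = t1"
    using padd_commute[OF cl(1,2) uv(3)] uv(6) by simp
  then show ?thesis
    using t0 t1 by simp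
qed

lemma padd_eq_zeroD:
  assumes "a \<in> carrier A" "b \<in> carrier A" "padd A a b = Some (pzero A)"
  shows "a = pzero A"
  using assms below_antisym[of a "pzero A"] pzero_closed by auto

text \<open>This is countable refinement for \<open>c, d, 0, 0, ...\<close>. From index 2 on, the
  two pieces of each term add up to 0, so they vanish and only a two by two matrix remains.\<close>

lemma padd_refinement:
  assumes c: "a \<in> carrier A" "b \<in> carrier A" "c \<in> carrier A" "d \<in> carrier A"
    and ab: "padd A a b = Some s" and cd: "padd A c d = Some s"
  obtains p q r t where "p \<in> carrier A" "q \<in> carrier A" "r \<in> carrier A" "t \<in> carrier A"
    "padd A p q = Some a" "padd A r t = Some b" "padd A p r = Some c" "padd A q t = Some d"
proof -
  let ?f = "case_nat c (case_nat d zeros)"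
  have "psum A ?f = Some s"
    using psum_pair_iff c cd by simp
  then obtain x y where xy: "range x \<subseteq> carrier A" "range y \<subseteq> carrier A"
      "psum A x = Some a" "psum A y = Some b" "\<And>n. padd A (x n) (y n) = Some (?f n)"
    using refinement[OF c(1,2) _ ab] range_case_nat range_zeros c by metis
  have in_c: "x n \<in> carrier A" "y n \<in> carrier A" for n
    using xy by auto
  have "padd A (x (Suc (Suc n))) (y (Suc (Suc n))) = Some (pzero A)" for n
    using xy(5)[of "Suc (Suc n)"] by simp
  then have "x (Suc (Suc n)) = pzero A" "y (Suc (Suc n)) = pzero A" for n
    using padd_eq_zeroD in_c padd_commute by meson+
  then have "x = case_nat (x 0) (case_nat (x 1) zeros)" "y = case_nat (y 0) (case_nat (y 1) zeros)"
    by (auto simp: fun_eq_iff split: nat.split)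
  then have "padd A (x 0) (x 1) = Some a" "padd A (y 0) (y 1) = Some b"
    using psum_pair_iff in_c xy by metis+
  then show thesis
    using xy(5)[of 0] xy(5)[of 1] by (intro that[of "x 0" "x 1" "y 0" "y 1"] in_c) simp_all
qed

subsection \<open>Joins\<close>

definition is_join :: "'a \<Rightarrow> 'a set \<Rightarrow> bool" where
  "is_join j X \<longleftrightarrow> j \<in> carrier A \<and> (\<forall>x\<in>X. x \<preceq> j) \<and> (\<forall>u\<in>carrier A. (\<forall>x\<in>X. x \<preceq> u) \<longrightarrow> j \<preceq> u)"

lemma obtain_join:
  assumes "has_countable_joins A" "X \<subseteq> carrier A" "countable X"
  obtains j where "is_join j X"
proof -
  obtain j where "least (gca_order A) j (Upper (gca_order A) X)"
    using assms unfolding has_countable_joins_def by blast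
  then have "is_join j X"
    using assms(2) unfolding least_def Upper_def is_join_def gca_order_def
    by (auto simp: subset_iff)
  with that show thesis by blast
qed

text \<open>Disjointification: \<open>u n\<close> collects the first \<open>n\<close> elements, \<open>r n\<close> is the rest of \<open>j\<close>,
  and \<open>x n\<close> is the part of \<open>a n\<close> that is taken from \<open>r n\<close>.\<close>

lemma join_below_psum:
  assumes j: "j \<in> carrier A" and a: "range a \<subseteq> carrier A" and aj: "\<And>n. a n \<preceq> j"
  obtains x s where "range x \<subseteq> carrier A" "psum A x = Some s" "\<And>n. x n \<preceq> a n" "\<And>n. a n \<preceq> s"
proof -
  let ?I = "\<lambda>n z. (n = (0::nat) \<longrightarrow> fst z = pzero A) \<and> fst z \<in> carrier A \<and> snd z \<in> carrier A \<and>
    padd A (fst z) (snd z) = Some j"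
  let ?S = "\<lambda>n z z'. \<exists>x\<in>carrier A. padd A (fst z) x = Some (fst z') \<and>
    padd A x (snd z') = Some (snd z) \<and> x \<preceq> a n \<and> a n \<preceq> fst z'"
  have "\<exists>f. \<forall>n. ?I n (f n) \<and> ?S n (f n) (f (Suc n))"
  proof (rule dependent_nat_choice[of ?I ?S])
    show "\<exists>z. ?I 0 z"
      using j pzero_closed by (intro exI[of _ "(pzero A, j)"]) auto
  next
    fix z n
    assume "?I n z"
    then obtain u r where z: "z = (u, r)" "u \<in> carrier A" "r \<in> carrier A" "padd A u r = Some j"
      by (cases z) auto
    obtain a' where a': "a' \<in> carrier A" "padd A (a n) a' = Some j"
      using aj by blast
    have an: "a n \<in> carrier A" using a by auto
    \<comment> \<open>Refining the two splittings \<open>a n + a'\<close> and \<open>u + r\<close>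
      of \<open>j\<close>: \<open>p\<close> is the share of \<open>a n\<close> already collected in
      \<open>u\<close>, and \<open>x\<close> is its new share, found in \<open>r\<close>. Since
      \<open>q + p = u\<close>, adding \<open>x\<close> to \<open>u\<close> gives
      \<open>q + a n\<close>, which is above \<open>a n\<close>.\<close>
    obtain p x q r' where ref: "p \<in> carrier A" "x \<in> carrier A" "q \<in> carrier A" "r' \<in> carrier A"
      "padd A p x = Some (a n)" "padd A q r' = Some a'" "padd A p q = Some u" "padd A x r' = Some r"
      using padd_refinement[OF an a'(1) z(2,3) a'(2) z(4)] by blast
    obtain u' where u': "padd A u x = Some u'" "padd A u' r' = Some j"
      using padd_assoc[OF z(2) ref(2,4,8) z(4)] by blast
    have "padd A q p = Some u"
      using padd_commute ref by blast
    then obtain w where "padd A p x = Some w" "padd A q w = Some u'"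
      using padd_assoc'[OF ref(3,1,2) _ u'(1)] by blast
    then have "padd A q (a n) = Some u'"
      using ref(5) by simp
    then have "a n \<preceq> u'"
      using padd_commute[OF ref(3) an] ref(3) by blast
    moreover have "x \<preceq> a n"
      using padd_commute ref by blast
    moreover have "u' \<in> carrier A"
      using padd_closed u' z(2) ref(2) by blast
    ultimately show "\<exists>z'. ?I (Suc n) z' \<and> ?S n z z'"
      using u' ref z by (intro exI[of _ "(u', r')"]) auto
  qed
  then obtain f where f: "\<And>n. ?I n (f n)" "\<And>n. ?S n (f n) (f (Suc n))"
    by blast
  define u r where "u n = fst (f n)" and "r n = snd (f n)" for n
  have ur: "u n \<in> carrier A" "r n \<in> carrier A" "padd A (u n) (r n) = Some j" for n
    using f(1)[of n] by (auto simp: u_def r_def split_beta)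
  have "\<exists>x\<in>carrier A. padd A (u n) x = Some (u (Suc n)) \<and> padd A x (r (Suc n)) = Some (r n) \<and>
    x \<preceq> a n \<and> a n \<preceq> u (Suc n)" for n
    using f(2)[of n] by (simp add: u_def r_def split_beta)
  then obtain x where x: "\<And>n. x n \<in> carrier A" "\<And>n. padd A (u n) (x n) = Some (u (Suc n))"
    "\<And>n. padd A (x n) (r (Suc n)) = Some (r n)" "\<And>n. x n \<preceq> a n" "\<And>n. a n \<preceq> u (Suc n)"
    by metis
  have u0: "u 0 = pzero A"
    using f(1)[of 0] by (auto simp: u_def split_beta)
  have rx: "range x \<subseteq> carrier A" "range r \<subseteq> carrier A"
    using x(1) ur by auto
  \<comment> \<open>The rests \<open>r n\<close> act as remainders of the sequence \<open>x\<close>;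
    this is what makes its sum defined.\<close>
  obtain s where "psum A (\<lambda>i. x (0 + i)) = Some s"
    using remainder[OF rx(2,1) x(3)] by blast
  then have s: "psum A x = Some s" by simp
  obtain t where t: "range t \<subseteq> carrier A" "t 0 = s" "\<And>n. padd A (x n) (t (Suc n)) = Some (t n)"
    using psum_tails[OF rx(1) s] by metis
  have tc: "t n \<in> carrier A" for n
    using t(1) by auto
  have ut: "padd A (u n) (t n) = Some s" for n
  proof (induction n)
    case 0
    then show ?case using u0 t(2) tc[of 0] by simp
  next
    case (Suc n)
    then obtain v where "padd A (u n) (x n) = Some v" "padd A v (t (Suc n)) = Some s"
      using padd_assoc[OF ur(1) x(1) tc t(3)] by blast
    then show ?case using x(2)[of n] by simp
  qed
  have "a n \<preceq> s" for n
  proof (rule below_trans[OF _ _ x(5)[of n]])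
    show "u (Suc n) \<preceq> s" using ut tc by blast
  qed (use a in auto)
  with that rx s x(4) show thesis by blast
qed

section \<open>Finite measures\<close>

lemma finite_measure_on_iff:
  "finite_measure_on A \<mu> \<longleftrightarrow> (\<forall>a\<in>carrier A. 0 \<le> \<mu> a) \<and>
    (\<forall>a\<in>carrier A. \<forall>b\<in>carrier A. \<forall>s. padd A a b = Some s \<longrightarrow> \<mu> a + \<mu> b = \<mu> s) \<and>
    \<mu> (pzero A) = 0 \<and>
    (\<forall>f s. range f \<subseteq> carrier A \<and> psum A f = Some s \<longrightarrow> (\<lambda>n. \<mu> (f n)) sums \<mu> s)"
proof -
  have "(if summable h then Some (suminf h) else None) = Some v \<longleftrightarrow> h sums v" for h and v :: real
    by (simp add: sums_iff)
  then show ?thesis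
    unfolding finite_measure_on_def gca_hom_def nonneg_reals_def by (simp add: Pi_iff)
qed

lemma
  assumes \<mu>: "finite_measure_on A \<mu>"
  shows finite_measure_nonneg: "a \<in> carrier A \<Longrightarrow> 0 \<le> \<mu> a"
    and finite_measure_zero: "\<mu> (pzero A) = 0"
    and finite_measure_padd: "\<lbrakk>a \<in> carrier A; b \<in> carrier A; padd A a b = Some s\<rbrakk> \<Longrightarrow> \<mu> s = \<mu> a + \<mu> b"
    and finite_measure_psum: "\<lbrakk>range f \<subseteq> carrier A; psum A f = Some s\<rbrakk> \<Longrightarrow> (\<lambda>n. \<mu> (f n)) sums \<mu> s"
  using \<mu> unfolding finite_measure_on_iff by metis+

lemma finite_measure_mono:
  assumes "finite_measure_on A \<mu>" "a \<in> carrier A" "a \<preceq> b"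
  shows "\<mu> a \<le> \<mu> b"
  using assms finite_measure_padd finite_measure_nonneg by fastforce

text \<open>Countable subadditivity for joins. The disjointified pieces of the \<open>a n\<close>
  have a sum \<open>s\<close> above every \<open>a n\<close>, hence above \<open>j\<close>, and each
  piece has at most the measure of its \<open>a n\<close>.\<close>

lemma finite_measure_join_le:
  assumes \<mu>: "finite_measure_on A \<mu>" and j: "is_join j (range a)" and a: "range a \<subseteq> carrier A"
    and summ: "summable (\<lambda>n. \<mu> (a n))"
  shows "\<mu> j \<le> (\<Sum>n. \<mu> (a n))"
proof -
  have jc: "j \<in> carrier A" "\<And>n. a n \<preceq> j"
    using j by (auto simp: is_join_def)
  obtain x s where x: "range x \<subseteq> carrier A" "psum A x = Some s" "\<And>n. x n \<preceq> a n"
    and s: "\<And>n. a n \<preceq> s"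
    using join_below_psum[OF jc(1) a jc(2)] by blast
  have sums: "(\<lambda>n. \<mu> (x n)) sums \<mu> s"
    by (rule finite_measure_psum[OF \<mu> x(1,2)])
  have "j \<preceq> s"
    using j s psum_closed[OF x(1,2)] by (auto simp: is_join_def)
  then have "\<mu> j \<le> \<mu> s"
    by (rule finite_measure_mono[OF \<mu> jc(1)])
  also have "\<mu> s = (\<Sum>n. \<mu> (x n))"
    using sums by (simp add: sums_iff)
  also have "\<dots> \<le> (\<Sum>n. \<mu> (a n))"
  proof (rule suminf_le)
    show "\<mu> (x n) \<le> \<mu> (a n)" for n
      by (rule finite_measure_mono[OF \<mu> _ x(3)]) (use x(1) in auto)
  qed (use sums summ in \<open>auto simp: sums_iff\<close>)
  finally show ?thesis .
qed

text \<open>Domination makes the values on the tails of a sum tend to \<open>0\<close>, which turns finite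
  into countable additivity.\<close>

lemma finite_measure_dominated:
  assumes \<mu>: "finite_measure_on A \<mu>"
    and nonneg: "\<And>a. a \<in> carrier A \<Longrightarrow> 0 \<le> m a"
    and le: "\<And>a. a \<in> carrier A \<Longrightarrow> m a \<le> \<mu> a"
    and add: "\<And>a b s. \<lbrakk>a \<in> carrier A; b \<in> carrier A; padd A a b = Some s\<rbrakk> \<Longrightarrow> m s = m a + m b"
  shows "finite_measure_on A m"
proof -
  have "(\<lambda>n. m (f n)) sums m s" if f: "range f \<subseteq> carrier A" "psum A f = Some s" for f s
  proof -
    obtain t where t: "range t \<subseteq> carrier A" "t 0 = s" "\<And>n. padd A (f n) (t (Suc n)) = Some (t n)"
      using psum_tails[OF f] by metis
    have fc: "f n \<in> carrier A" and tc: "t n \<in> carrier A" for n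
      using f t by auto
    \<comment> \<open>Stated for an arbitrary additive function because it is used twice: for
      \<open>\<mu>\<close> to show that the tails become small, and for \<open>m\<close> to express
      its partial sums.\<close>
    have partial: "\<kappa> s = (\<Sum>i<n. \<kappa> (f i)) + \<kappa> (t n)"
      if "\<And>a b s. \<lbrakk>a \<in> carrier A; b \<in> carrier A; padd A a b = Some s\<rbrakk> \<Longrightarrow> \<kappa> s = \<kappa> a + \<kappa> b"
      for \<kappa> :: "'a \<Rightarrow> real" and n
    proof (induction n)
      case (Suc n)
      then show ?case
        using that[OF fc tc t(3)[of n]] by simp
    qed (use t in simp)
    have "(\<lambda>n. \<mu> s - (\<Sum>i<n. \<mu> (f i))) \<longlonglongrightarrow> \<mu> s - \<mu> s"
      using finite_measure_psum[OF \<mu> f] by (intro tendsto_intros) (simp add: sums_def)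
    moreover have "\<mu> s - (\<Sum>i<n. \<mu> (f i)) = \<mu> (t n)" for n
      using partial[of \<mu> n, OF finite_measure_padd[OF \<mu>]] by linarith
    ultimately have "(\<lambda>n. \<mu> (t n)) \<longlonglongrightarrow> 0"
      by simp
    from tendsto_sandwich[OF _ _ tendsto_const this] have "(\<lambda>n. m (t n)) \<longlonglongrightarrow> 0"
      by (simp add: nonneg le tc)
    then have "(\<lambda>n. m s - m (t n)) \<longlonglongrightarrow> m s - 0"
      by (intro tendsto_intros)
    moreover have "m s - m (t n) = (\<Sum>i<n. m (f i))" for n
      using partial[of m n, OF add] by linarith
    ultimately show ?thesis
      by (simp add: sums_def)
  qed
  moreover have "m (pzero A) = 0"
    using nonneg[OF pzero_closed] le[OF pzero_closed] finite_measure_zero[OF \<mu>] by simp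
  ultimately show ?thesis
    unfolding finite_measure_on_iff using nonneg add by metis
qed

lemma finite_measure_diff:
  assumes "finite_measure_on A \<mu>" "finite_measure_on A m" "\<And>a. a \<in> carrier A \<Longrightarrow> m a \<le> \<mu> a"
  shows "finite_measure_on A (\<lambda>a. \<mu> a - m a)"
  using assms finite_measure_nonneg[OF assms(2)] finite_measure_padd[OF assms(1)]
    finite_measure_padd[OF assms(2)]
  by (intro finite_measure_dominated[OF assms(1)]) auto

section \<open>Meets of finite measures, by the Riesz-Kantorovich formula\<close>

definition meas_inf :: "('a \<Rightarrow> real) \<Rightarrow> ('a \<Rightarrow> real) \<Rightarrow> 'a \<Rightarrow> real" where
  "meas_inf \<mu> \<nu> a = Inf {\<mu> b + \<nu> c | b c. b \<in> carrier A \<and> c \<in> carrier A \<and> padd A b c = Some a}"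

context
  fixes \<mu> \<nu>
  assumes \<mu>: "finite_measure_on A \<mu>" and \<nu>: "finite_measure_on A \<nu>"
begin

lemma meas_inf_le:
  assumes "b \<in> carrier A" "c \<in> carrier A" "padd A b c = Some a"
  shows "meas_inf \<mu> \<nu> a \<le> \<mu> b + \<nu> c"
  unfolding meas_inf_def
proof (rule cInf_lower)
  show "bdd_below {\<mu> b + \<nu> c | b c. b \<in> carrier A \<and> c \<in> carrier A \<and> padd A b c = Some a}"
    by (rule bdd_belowI[of _ 0])
      (auto intro!: add_nonneg_nonneg finite_measure_nonneg[OF \<mu>] finite_measure_nonneg[OF \<nu>])
qed (use assms in blast)

lemma meas_inf_greatest:
  assumes "a \<in> carrier A"
    and "\<And>b c. \<lbrakk>b \<in> carrier A; c \<in> carrier A; padd A b c = Some a\<rbrakk> \<Longrightarrow> x \<le> \<mu> b + \<nu> c"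
  shows "x \<le> meas_inf \<mu> \<nu> a"
proof -
  have "\<exists>b c. b \<in> carrier A \<and> c \<in> carrier A \<and> padd A b c = Some a"
    using assms(1) pzero_closed padd_zero_right by blast
  then show ?thesis
    unfolding meas_inf_def using assms(2) by (intro cInf_greatest) blast+
qed

lemma meas_inf_approx:
  assumes "a \<in> carrier A" "meas_inf \<mu> \<nu> a < x"
  obtains b c where "b \<in> carrier A" "c \<in> carrier A" "padd A b c = Some a" "\<mu> b + \<nu> c < x"
  using meas_inf_greatest[OF assms(1), of x] assms(2) by force

lemma meas_inf_le_left: "a \<in> carrier A \<Longrightarrow> meas_inf \<mu> \<nu> a \<le> \<mu> a"
  and meas_inf_le_right: "a \<in> carrier A \<Longrightarrow> meas_inf \<mu> \<nu> a \<le> \<nu> a"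
  using meas_inf_le[of a "pzero A" a] meas_inf_le[of "pzero A" a a] pzero_closed
    finite_measure_zero[OF \<mu>] finite_measure_zero[OF \<nu>] by auto

text \<open>Near-optimal splittings of \<open>a\<close> and \<open>b\<close> combine by interchange
  into a splitting of \<open>s\<close>, giving one inequality; any splitting of \<open>s\<close>
  refines into splittings of \<open>a\<close> and \<open>b\<close>, giving the other. Domination by
  \<open>\<mu>\<close> supplies countable additivity.\<close>

lemma finite_measure_meas_inf: "finite_measure_on A (meas_inf \<mu> \<nu>)"
proof (rule finite_measure_dominated[OF \<mu> _ meas_inf_le_left])
  fix a assume "a \<in> carrier A"
  then show "0 \<le> meas_inf \<mu> \<nu> a"
    by (intro meas_inf_greatest add_nonneg_nonneg finite_measure_nonneg[OF \<mu>] finite_measure_nonneg[OF \<nu>])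
next
  fix a b s
  assume a: "a \<in> carrier A" and b: "b \<in> carrier A" and s: "padd A a b = Some s"
  have sc: "s \<in> carrier A"
    using padd_closed a b s by blast
  note \<mu>_add = finite_measure_padd[OF \<mu>] and \<nu>_add = finite_measure_padd[OF \<nu>]
  show "meas_inf \<mu> \<nu> s = meas_inf \<mu> \<nu> a + meas_inf \<mu> \<nu> b"
  proof (rule antisym)
    show "meas_inf \<mu> \<nu> s \<le> meas_inf \<mu> \<nu> a + meas_inf \<mu> \<nu> b"
    proof (rule field_le_epsilon)
      fix e :: real
      assume e: "0 < e"
      obtain a1 a2 where 1: "a1 \<in> carrier A" "a2 \<in> carrier A" "padd A a1 a2 = Some a"
        "\<mu> a1 + \<nu> a2 < meas_inf \<mu> \<nu> a + e / 2"
        using meas_inf_approx[OF a, of "meas_inf \<mu> \<nu> a + e / 2"] e by auto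
      obtain b1 b2 where 2: "b1 \<in> carrier A" "b2 \<in> carrier A" "padd A b1 b2 = Some b"
        "\<mu> b1 + \<nu> b2 < meas_inf \<mu> \<nu> b + e / 2"
        using meas_inf_approx[OF b, of "meas_inf \<mu> \<nu> b + e / 2"] e by auto
      obtain u v where uv: "padd A a1 b1 = Some u" "padd A a2 b2 = Some v" "padd A u v = Some s"
        using padd_interchange[OF 1(1,2) 2(1,2) 1(3) 2(3) s] by blast
      then have "meas_inf \<mu> \<nu> s \<le> \<mu> u + \<nu> v"
        using padd_closed 1 2 by (intro meas_inf_le) blast+
      also have "\<dots> = \<mu> a1 + \<mu> b1 + (\<nu> a2 + \<nu> b2)"
        using \<mu>_add[OF 1(1) 2(1) uv(1)] \<nu>_add[OF 1(2) 2(2) uv(2)] by simp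
      finally show "meas_inf \<mu> \<nu> s \<le> meas_inf \<mu> \<nu> a + meas_inf \<mu> \<nu> b + e"
        using 1(4) 2(4) by simp
    qed
    show "meas_inf \<mu> \<nu> a + meas_inf \<mu> \<nu> b \<le> meas_inf \<mu> \<nu> s"
    proof (rule meas_inf_greatest[OF sc])
      fix x y
      assume x: "x \<in> carrier A" and y: "y \<in> carrier A" and xy: "padd A x y = Some s"
      obtain p q r t where c: "p \<in> carrier A" "q \<in> carrier A" "r \<in> carrier A" "t \<in> carrier A"
        and eq: "padd A p q = Some a" "padd A r t = Some b" "padd A p r = Some x" "padd A q t = Some y"
        using padd_refinement[OF a b x y s xy] by blast
      have "meas_inf \<mu> \<nu> a \<le> \<mu> p + \<nu> q" "meas_inf \<mu> \<nu> b \<le> \<mu> r + \<nu> t"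
        using c eq by (auto intro: meas_inf_le)
      then show "meas_inf \<mu> \<nu> a + meas_inf \<mu> \<nu> b \<le> \<mu> x + \<nu> y"
        using \<mu>_add[OF c(1,3) eq(3)] \<nu>_add[OF c(2,4) eq(4)] by simp
    qed
  qed
qed

end

section \<open>Pullbacks and decreasing limits of measures\<close>

lemma finite_measure_hom_comp:
  assumes "gca_hom A A h" "finite_measure_on A \<mu>"
  shows "finite_measure_on A (\<lambda>a. \<mu> (h a))"
  using assms unfolding finite_measure_on_def gca_hom_def
  by (auto simp: Pi_iff image_subset_iff)

text \<open>The remainders decrease pointwise and are bounded below by 0. Their limit is additive
  and dominated by \<open>P 0\<close>, hence a measure, and the subtracted amounts
  telescope.\<close>

lemma finite_measure_residual:
  fixes P M :: "nat \<Rightarrow> 'a \<Rightarrow> real"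
  assumes P: "\<And>n. finite_measure_on A (P n)" and M: "\<And>n. finite_measure_on A (M n)"
    and step: "\<And>n a. P (Suc n) a = P n a - M n a"
  obtains \<pi> where "finite_measure_on A \<pi>" "\<And>n a. a \<in> carrier A \<Longrightarrow> \<pi> a \<le> P n a"
    "\<And>a. a \<in> carrier A \<Longrightarrow> (\<lambda>n. M n a) sums (P 0 a - \<pi> a)"
proof -
  have "\<exists>L. (\<lambda>n. P n a) \<longlonglongrightarrow> L \<and> (\<forall>n. L \<le> P n a)" if a: "a \<in> carrier A" for a
  proof (rule decseq_convergent[of "\<lambda>n. P n a" 0])
    show "decseq (\<lambda>n. P n a)"
      using finite_measure_nonneg[OF M a] by (intro decseq_SucI) (simp add: step)
    show "\<forall>n. 0 \<le> P n a"
      using finite_measure_nonneg[OF P a] by blast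
  qed blast
  then obtain \<pi> where lim: "\<And>a. a \<in> carrier A \<Longrightarrow> (\<lambda>n. P n a) \<longlonglongrightarrow> \<pi> a"
    and le: "\<And>n a. a \<in> carrier A \<Longrightarrow> \<pi> a \<le> P n a"
    by metis
  have "finite_measure_on A \<pi>"
  proof (rule finite_measure_dominated[OF P[of 0] _ le])
    fix a assume a: "a \<in> carrier A"
    show "0 \<le> \<pi> a"
      by (rule LIMSEQ_le_const[OF lim[OF a]]) (use finite_measure_nonneg[OF P a] in blast)
  next
    fix a b s
    assume ab: "a \<in> carrier A" "b \<in> carrier A" "padd A a b = Some s"
    have "(\<lambda>n. P n s) \<longlonglongrightarrow> \<pi> a + \<pi> b"
      using tendsto_add[OF lim[OF ab(1)] lim[OF ab(2)]] finite_measure_padd[OF P ab] by simp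
    then show "\<pi> s = \<pi> a + \<pi> b"
      using LIMSEQ_unique lim[OF padd_closed[OF ab]] by blast
  qed
  moreover have "(\<lambda>n. M n a) sums (P 0 a - \<pi> a)" if "a \<in> carrier A" for a
  proof -
    have "(\<Sum>i<n. M i a) = P 0 a - P n a" for n
      by (induction n) (simp_all add: step)
    then show ?thesis
      unfolding sums_def using tendsto_diff[OF tendsto_const lim[OF that]] by simp
  qed
  ultimately show thesis
    using le that by blast
qed

end

section \<open>Invariant elements and equidecomposability\<close>

context gamma_gca
begin

lemma group_Gamma: "Group.group \<Gamma>"
  using group_hom group_hom.axioms(1) by blast

lemma act_closed: "\<lbrakk>\<gamma> \<in> carrier \<Gamma>; a \<in> carrier A\<rbrakk> \<Longrightarrow> act \<gamma> a \<in> carrier A"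
  using element_image by blast

lemma act_padd:
  assumes "\<gamma> \<in> carrier \<Gamma>" "a \<in> carrier A" "b \<in> carrier A" "padd A a b = Some s"
  shows "padd A (act \<gamma> a) (act \<gamma> b) = Some (act \<gamma> s)"
  using act_hom[OF assms(1)] assms(2-4) unfolding gca_hom_def by blast

lemma act_mono:
  assumes "\<gamma> \<in> carrier \<Gamma>" "a \<in> carrier A" "a \<preceq> b"
  shows "act \<gamma> a \<preceq> act \<gamma> b"
  using assms act_padd act_closed by blast

lemma inv_closed: "\<gamma> \<in> carrier \<Gamma> \<Longrightarrow> inv\<^bsub>\<Gamma>\<^esub> \<gamma> \<in> carrier \<Gamma>"
  using group.inv_closed[OF group_Gamma] .

lemma act_inv_act: "\<lbrakk>\<gamma> \<in> carrier \<Gamma>; a \<in> carrier A\<rbrakk> \<Longrightarrow> act (inv\<^bsub>\<Gamma>\<^esub> \<gamma>) (act \<gamma> a) = a"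
  using orbit_sym_aux by blast

lemma act_act_inv: "\<lbrakk>\<gamma> \<in> carrier \<Gamma>; a \<in> carrier A\<rbrakk> \<Longrightarrow> act \<gamma> (act (inv\<^bsub>\<Gamma>\<^esub> \<gamma>) a) = a"
  using act_inv_act[OF inv_closed] group.inv_inv[OF group_Gamma] by metis

lemma finite_measure_act:
  "\<lbrakk>\<gamma> \<in> carrier \<Gamma>; finite_measure_on A \<mu>\<rbrakk> \<Longrightarrow> finite_measure_on A (\<lambda>a. \<mu> (act \<gamma> a))"
  using finite_measure_hom_comp act_hom by blast

lemma finite_measure_act_measure:
  "\<lbrakk>\<gamma> \<in> carrier \<Gamma>; finite_measure_on A \<mu>\<rbrakk> \<Longrightarrow> finite_measure_on A (act_measure \<Gamma> act \<gamma> \<mu>)"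
  unfolding act_measure_def by (intro finite_measure_act inv_closed)

lemma act_measure_invariant:
  "\<lbrakk>\<gamma> \<in> carrier \<Gamma>; gamma_invariant \<Gamma> act a\<rbrakk> \<Longrightarrow> act_measure \<Gamma> act \<gamma> \<mu> a = \<mu> a"
  using inv_closed by (simp add: act_measure_def gamma_invariant_def)

section \<open>Enumeration of the group and joins of orbits\<close>

abbreviation enum :: "nat \<Rightarrow> 'g"
  where "enum \<equiv> from_nat_into (carrier \<Gamma>)"

lemma carrier_nonempty: "carrier \<Gamma> \<noteq> {}"
  using monoid.one_closed[OF group.is_monoid[OF group_Gamma]] by blast

lemma enum_closed: "enum n \<in> carrier \<Gamma>"
  by (rule from_nat_into[OF carrier_nonempty])

lemma enum_surj:
  assumes "\<gamma> \<in> carrier \<Gamma>"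
  obtains n where "enum n = \<gamma>"
  using from_nat_into_surj[OF countable_group assms] by blast

lemma range_act_enum: "a \<in> carrier A \<Longrightarrow> range (\<lambda>n. act (enum n) a) \<subseteq> carrier A"
  using act_closed enum_closed by blast

text \<open>Translation by \<open>\<gamma>\<close> permutes the orbit of \<open>c\<close>, so
  \<open>act \<gamma> a\<close> bounds the orbit and lies above its join \<open>a\<close>. Using
  this for the inverse of \<open>\<gamma>\<close> and translating back by \<open>\<gamma>\<close>
  gives the reverse inequality.\<close>

lemma orbit_join_invariant:
  assumes joins: "has_countable_joins A" and c: "c \<in> carrier A"
  obtains a where "is_join a (range (\<lambda>n. act (enum n) c))" "gamma_invariant \<Gamma> act a"
    "a \<in> carrier A" "c \<preceq> a"
proof -
  obtain a where a: "is_join a (range (\<lambda>n. act (enum n) c))"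
    using obtain_join[OF joins range_act_enum[OF c]] by auto
  have ac: "a \<in> carrier A"
    using a by (simp add: is_join_def)
  have orbit: "act \<gamma> c \<preceq> a" if \<gamma>: "\<gamma> \<in> carrier \<Gamma>" for \<gamma>
  proof -
    obtain n where "enum n = \<gamma>"
      by (rule enum_surj[OF \<gamma>])
    moreover have "\<forall>x\<in>range (\<lambda>n. act (enum n) c). x \<preceq> a"
      using a unfolding is_join_def by (elim conjE)
    ultimately show ?thesis by auto
  qed
  have le: "a \<preceq> act \<gamma> a" if \<gamma>: "\<gamma> \<in> carrier \<Gamma>" for \<gamma>
  proof -
    have *: "act \<delta> c \<preceq> act \<gamma> a" if \<delta>: "\<delta> \<in> carrier \<Gamma>" for \<delta>
    proof -
      \<comment> \<open>Every orbit element is a \<open>\<gamma>\<close>-translate of another one,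
        as \<open>\<delta>\<close> is the product of \<open>\<gamma>\<close> and this
        element.\<close>
      have prod: "inv\<^bsub>\<Gamma>\<^esub> \<gamma> \<otimes>\<^bsub>\<Gamma>\<^esub> \<delta> \<in> carrier \<Gamma>"
        using group.is_monoid[OF group_Gamma] inv_closed[OF \<gamma>] \<delta> by (rule monoid.m_closed)
      have "act \<gamma> (act (inv\<^bsub>\<Gamma>\<^esub> \<gamma> \<otimes>\<^bsub>\<Gamma>\<^esub> \<delta>) c) \<preceq> act \<gamma> a"
        by (rule act_mono[OF \<gamma> act_closed[OF prod c] orbit[OF prod]])
      then show ?thesis
        using composition_rule[OF c inv_closed[OF \<gamma>] \<delta>] act_act_inv[OF \<gamma> act_closed[OF \<delta> c]] by simp
    qed
    have "\<forall>x\<in>range (\<lambda>n. act (enum n) c). x \<preceq> act \<gamma> a"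
      using *[OF enum_closed] by simp
    with a act_closed[OF \<gamma> ac] show ?thesis
      unfolding is_join_def by simp
  qed
  have "act \<gamma> a = a" if \<gamma>: "\<gamma> \<in> carrier \<Gamma>" for \<gamma>
  proof (rule below_antisym[OF act_closed[OF \<gamma> ac] ac _ le[OF \<gamma>]])
    show "act \<gamma> a \<preceq> a"
      using act_mono[OF \<gamma> ac le[OF inv_closed[OF \<gamma>]]] act_act_inv[OF \<gamma> ac] by simp
  qed
  then have "gamma_invariant \<Gamma> act a"
    by (simp add: gamma_invariant_def)
  moreover have "c \<preceq> a"
  proof -
    have one: "\<one>\<^bsub>\<Gamma>\<^esub> \<in> carrier \<Gamma>"
      using group.is_monoid[OF group_Gamma] by (rule monoid.one_closed)
    have "act \<one>\<^bsub>\<Gamma>\<^esub> c = c"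
      using id_eq_one c by (metis restrict_apply')
    then show ?thesis using orbit[OF one] by simp
  qed
  ultimately show thesis
    using that a ac by blast
qed

text \<open>A Borel--Cantelli argument: splitting \<open>x\<close> as \<open>b n + c n\<close> with small values of \<open>\<mu> (b n)\<close> and of
  \<open>\<nu>\<close> at the translate of \<open>c n\<close>, the complement \<open>d\<close> of the join of the \<open>b n\<close> has positive \<open>\<mu>\<close> but its
  whole orbit is \<open>\<nu>\<close>-null. Each group element has to occur infinitely often, hence the indexing
  by pairs.\<close>

lemma singular_imp_zero:
  assumes joins: "has_countable_joins A"
    and \<mu>: "finite_measure_on A \<mu>" and \<nu>: "finite_measure_on A \<nu>"
    and agree: "\<And>a. \<lbrakk>a \<in> carrier A; gamma_invariant \<Gamma> act a\<rbrakk> \<Longrightarrow> \<mu> a = \<nu> a"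
    and sing: "\<And>x \<gamma> e. \<lbrakk>x \<in> carrier A; \<gamma> \<in> carrier \<Gamma>; 0 < e\<rbrakk> \<Longrightarrow>
      \<exists>b\<in>carrier A. \<exists>c\<in>carrier A. padd A b c = Some x \<and> \<mu> b + \<nu> (act \<gamma> c) < e"
    and x: "x \<in> carrier A"
  shows "\<mu> x = 0"
proof (rule ccontr)
  assume "\<mu> x \<noteq> 0"
  then have pos: "0 < \<mu> x"
    using finite_measure_nonneg[OF \<mu> x] by simp
  note \<nu>_act = finite_measure_act[OF _ \<nu>]
  define g where "g n = enum (fst (prod_decode n))" for n
  \<comment> \<open>The bounds add up to half of \<open>\<mu> x\<close>, so the join of the
    \<open>b n\<close> cannot exhaust \<open>x\<close>.\<close>
  define e where "e n = \<mu> x / 2 * (1 / 2) ^ Suc n" for n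
  have g: "g n \<in> carrier \<Gamma>" for n
    by (simp add: g_def enum_closed)
  have e: "0 < e n" for n
    using pos by (simp add: e_def)
  have e_sums: "e sums (\<mu> x / 2)"
    using sums_mult[OF power_half_series, of "\<mu> x / 2"] by (simp add: e_def[abs_def])
  have "\<exists>b c. b \<in> carrier A \<and> c \<in> carrier A \<and> padd A b c = Some x \<and> \<mu> b + \<nu> (act (g n) c) < e n" for n
    using sing[OF x g e] by blast
  then obtain b c where bc: "\<And>n. b n \<in> carrier A" "\<And>n. c n \<in> carrier A" "\<And>n. padd A (b n) (c n) = Some x"
    "\<And>n. \<mu> (b n) + \<nu> (act (g n) (c n)) < e n"
    by metis
  have b_small: "\<mu> (b n) \<le> e n" and c_small: "\<nu> (act (g n) (c n)) < e n" for n
    using bc(4)[of n] finite_measure_nonneg[OF \<mu> bc(1)[of n]]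
      finite_measure_nonneg[OF \<nu>_act[OF g] bc(2)[of n], of n] by linarith+
  have range_b: "range b \<subseteq> carrier A"
    using bc(1) by blast
  obtain j where j: "is_join j (range b)"
    using obtain_join[OF joins range_b] by auto
  have jc: "j \<in> carrier A" and bj: "\<And>n. b n \<preceq> j"
    using j by (auto simp: is_join_def)
  have "b n \<preceq> x" for n
    using bc(2,3) by blast
  then have "j \<preceq> x"
    using j x by (auto simp: is_join_def)
  then obtain d where d: "d \<in> carrier A" "padd A j d = Some x"
    by blast
  have summ: "summable (\<lambda>n. \<mu> (b n))"
    by (rule summable_comparison_test'[OF sums_summable[OF e_sums], of 0])
      (use b_small finite_measure_nonneg[OF \<mu> bc(1)] in auto)
  have "\<mu> j \<le> (\<Sum>n. \<mu> (b n))"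
    by (rule finite_measure_join_le[OF \<mu> j range_b summ])
  also have "\<dots> \<le> suminf e"
    by (rule suminf_le[OF b_small summ sums_summable[OF e_sums]])
  also have "\<dots> = \<mu> x / 2"
    using e_sums by (simp add: sums_iff)
  finally have d_pos: "0 < \<mu> d"
    using finite_measure_padd[OF \<mu> jc d] pos by simp
  \<comment> \<open>\<open>d\<close> and \<open>c n\<close> complement \<open>j\<close> and
    \<open>b n\<close> in \<open>x\<close>, and \<open>b n\<close> lies below \<open>j\<close>. The
    resulting comparison of \<open>d\<close> with \<open>c n\<close> is made on values of
    \<open>\<nu>\<close>, where subtraction is possible.\<close>
  have d_small: "\<nu> (act (g n) d) < e n" for n
  proof -
    have "\<nu> (act (g n) (b n)) \<le> \<nu> (act (g n) j)"
      by (rule finite_measure_mono[OF \<nu>_act[OF g] bc(1) bj])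
    moreover have "\<nu> (act (g n) x) = \<nu> (act (g n) j) + \<nu> (act (g n) d)"
      by (rule finite_measure_padd[OF \<nu>_act[OF g] jc d])
    moreover have "\<nu> (act (g n) x) = \<nu> (act (g n) (b n)) + \<nu> (act (g n) (c n))"
      by (rule finite_measure_padd[OF \<nu>_act[OF g] bc(1-3)])
    ultimately show ?thesis
      using c_small[of n] by linarith
  qed
  have null: "\<nu> (act (enum i) d) = 0" for i
  proof -
    have "\<nu> (act (enum i) d) \<le> e k" for k
    proof -
      \<comment> \<open>The \<open>i\<close>-th group element is used at every index
        \<open>prod_encode (i, k)\<close>. This index is at least \<open>k\<close> and
        \<open>e\<close> decreases, so letting \<open>k\<close> grow forces the value to 0.\<close>
      have "\<nu> (act (enum i) d) < e (prod_encode (i, k))"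
        using d_small[of "prod_encode (i, k)"] by (simp add: g_def)
      also have "\<dots> \<le> e k"
        unfolding e_def using pos le_prod_encode_2[of k i]
        by (intro mult_left_mono power_decreasing) auto
      finally show ?thesis by simp
    qed
    moreover have "e \<longlonglongrightarrow> 0"
      using e_sums summable_LIMSEQ_zero sums_summable by blast
    ultimately have "\<nu> (act (enum i) d) \<le> 0"
      by (intro LIMSEQ_le_const) auto
    then show ?thesis
      using finite_measure_nonneg[OF \<nu>_act[OF enum_closed] d(1)] by (simp add: antisym)
  qed
  obtain a where a: "is_join a (range (\<lambda>n. act (enum n) d))" "gamma_invariant \<Gamma> act a"
    "a \<in> carrier A" "d \<preceq> a"
    using orbit_join_invariant[OF joins d(1)] by blast
  have "\<nu> a \<le> (\<Sum>n. \<nu> (act (enum n) d))"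
    by (rule finite_measure_join_le[OF \<nu> a(1) range_act_enum[OF d(1)]]) (simp add: null)
  then have "\<mu> a \<le> 0"
    using agree[OF a(3,2)] by (simp add: null)
  then show False
    using finite_measure_mono[OF \<mu> d(1) a(4)] d_pos by linarith
qed

subsection \<open>Greedy decomposition\<close>

abbreviation index :: "'g \<Rightarrow> nat"
  where "index \<equiv> to_nat_on (carrier \<Gamma>)"

lemma enum_index: "\<gamma> \<in> carrier \<Gamma> \<Longrightarrow> enum (index \<gamma>) = \<gamma>"
  using countable_group by simp

text \<open>Nonnegativity turns the convergent series into an unordered sum. The hypothesis
  \<open>zero\<close> is vacuous for infinite \<open>\<Gamma>\<close>, where \<open>index\<close> is
  onto; for finite \<open>\<Gamma>\<close> it discards the surplus indices.\<close>

lemma has_sum_index: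
  fixes f :: "nat \<Rightarrow> real"
  assumes "f sums S" "\<And>n. 0 \<le> f n" and zero: "\<And>n. n \<notin> index ` carrier \<Gamma> \<Longrightarrow> f n = 0"
  shows "((\<lambda>\<gamma>. f (index \<gamma>)) has_sum S) (carrier \<Gamma>)"
proof -
  have "(f has_sum S) UNIV"
    by (rule sums_nonneg_imp_has_sum) fact+
  then have "(f has_sum S) (index ` carrier \<Gamma>)"
    using has_sum_cong_neutral[of UNIV "index ` carrier \<Gamma>" f f S] zero by auto
  then show ?thesis
    using has_sum_reindex[OF inj_on_to_nat_on[OF countable_group], of f S] by (simp add: o_def)
qed

text \<open>If \<open>\<Gamma>\<close> is finite, the indices outside \<open>index ` carrier \<Gamma>\<close> repeat an element under \<open>enum\<close>;
  nothing is transferred there.\<close>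

definition transfer :: "nat \<Rightarrow> ('a \<Rightarrow> real) \<Rightarrow> ('a \<Rightarrow> real) \<Rightarrow> 'a \<Rightarrow> real" where
  "transfer n \<mu> \<nu> =
    (if n \<in> index ` carrier \<Gamma> then meas_inf \<mu> (\<lambda>a. \<nu> (act (enum n) a)) else (\<lambda>_. 0))"

lemma
  assumes \<mu>: "finite_measure_on A \<mu>" and \<nu>: "finite_measure_on A \<nu>"
  shows finite_measure_transfer: "finite_measure_on A (transfer n \<mu> \<nu>)"
    and transfer_le_left: "a \<in> carrier A \<Longrightarrow> transfer n \<mu> \<nu> a \<le> \<mu> a"
    and act_transfer_le_right:
      "a \<in> carrier A \<Longrightarrow> act_measure \<Gamma> act (enum n) (transfer n \<mu> \<nu>) a \<le> \<nu> a"
proof -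
  have \<nu>': "finite_measure_on A (\<lambda>a. \<nu> (act (enum n) a))"
    by (rule finite_measure_act[OF enum_closed \<nu>])
  have zero: "finite_measure_on A (\<lambda>_. 0)"
    by (simp add: finite_measure_on_iff)
  show "finite_measure_on A (transfer n \<mu> \<nu>)"
    unfolding transfer_def using finite_measure_meas_inf[OF \<mu> \<nu>'] zero by simp
  assume a: "a \<in> carrier A"
  show "transfer n \<mu> \<nu> a \<le> \<mu> a"
    unfolding transfer_def
    using meas_inf_le_left[OF \<mu> \<nu>' a] finite_measure_nonneg[OF \<mu> a] by simp
  show "act_measure \<Gamma> act (enum n) (transfer n \<mu> \<nu>) a \<le> \<nu> a"
    unfolding transfer_def act_measure_def
    using meas_inf_le_right[OF \<mu> \<nu>' act_closed[OF inv_closed[OF enum_closed[of n]] a]]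
      act_act_inv[OF enum_closed[of n] a] finite_measure_nonneg[OF \<nu> a] by simp
qed

primrec residue ::
  "('a \<Rightarrow> real) \<Rightarrow> ('a \<Rightarrow> real) \<Rightarrow> nat \<Rightarrow> ('a \<Rightarrow> real) \<times> ('a \<Rightarrow> real)" where
  "residue \<mu> \<nu> 0 = (\<mu>, \<nu>)"
| "residue \<mu> \<nu> (Suc n) = (let (p, q) = residue \<mu> \<nu> n in
    (\<lambda>a. p a - transfer n p q a, \<lambda>a. q a - act_measure \<Gamma> act (enum n) (transfer n p q) a))"

lemma invariant_agree_imp_equidecomposable:
  assumes joins: "has_countable_joins A"
    and \<mu>: "finite_measure_on A \<mu>" and \<nu>: "finite_measure_on A \<nu>"
    and agree: "\<And>a. \<lbrakk>a \<in> carrier A; gamma_invariant \<Gamma> act a\<rbrakk> \<Longrightarrow> \<mu> a = \<nu> a"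
  shows "equidecomposable \<Gamma> A act \<mu> \<nu>"
proof -
  define P Q where "P n = fst (residue \<mu> \<nu> n)" and "Q n = snd (residue \<mu> \<nu> n)" for n
  define M N where "M n = transfer n (P n) (Q n)" and "N n = act_measure \<Gamma> act (enum n) (M n)" for n
  have zero: "P 0 = \<mu>" "Q 0 = \<nu>"
    by (simp_all add: P_def Q_def)
  have step: "P (Suc n) a = P n a - M n a" "Q (Suc n) a = Q n a - N n a" for n a
    by (simp_all add: P_def Q_def M_def N_def split_beta Let_def)
  have PQ: "finite_measure_on A (P n) \<and> finite_measure_on A (Q n)" for n
  proof (induction n)
    case 0
    then show ?case by (simp add: zero \<mu> \<nu>)
  next
    case (Suc n)
    then have P: "finite_measure_on A (P n)" and Q: "finite_measure_on A (Q n)"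
      by auto
    have "P (Suc n) = (\<lambda>a. P n a - M n a)" "Q (Suc n) = (\<lambda>a. Q n a - N n a)"
      by (auto simp: step)
    then show ?case
      using finite_measure_transfer[OF P Q, of n] transfer_le_left[OF P Q] act_transfer_le_right[OF P Q]
        finite_measure_diff[OF P] finite_measure_diff[OF Q] finite_measure_act_measure[OF enum_closed]
      unfolding M_def N_def by simp
  qed
  then have P: "finite_measure_on A (P n)" and Q: "finite_measure_on A (Q n)" for n
    by auto
  have M: "finite_measure_on A (M n)" for n
    unfolding M_def by (rule finite_measure_transfer[OF P Q])
  have N: "finite_measure_on A (N n)" for n
    unfolding N_def by (rule finite_measure_act_measure[OF enum_closed M])
  obtain \<pi> where \<pi>: "finite_measure_on A \<pi>" "\<And>n a. a \<in> carrier A \<Longrightarrow> \<pi> a \<le> P n a"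
    "\<And>a. a \<in> carrier A \<Longrightarrow> (\<lambda>n. M n a) sums (P 0 a - \<pi> a)"
    using finite_measure_residual[of P M, OF P M step(1)] by blast
  obtain \<rho> where \<rho>: "finite_measure_on A \<rho>" "\<And>n a. a \<in> carrier A \<Longrightarrow> \<rho> a \<le> Q n a"
    "\<And>a. a \<in> carrier A \<Longrightarrow> (\<lambda>n. N n a) sums (Q 0 a - \<rho> a)"
    using finite_measure_residual[of Q N, OF Q N step(2)] by blast
  \<comment> \<open>On an invariant element each step takes the same amount from both sides, so
    equality of \<open>\<mu>\<close> and \<open>\<nu>\<close> there passes to the limits.\<close>
  have agree': "\<pi> a = \<rho> a" if a: "a \<in> carrier A" "gamma_invariant \<Gamma> act a" for a
  proof -
    have "N n a = M n a" for n
      unfolding N_def by (rule act_measure_invariant[OF enum_closed a(2)])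
    then have "\<mu> a - \<pi> a = \<nu> a - \<rho> a"
      using sums_unique2[OF \<pi>(3)[OF a(1)]] \<rho>(3)[OF a(1)] by (simp add: zero)
    then show ?thesis
      using agree[OF a] by simp
  qed
  \<comment> \<open>Singularity at \<open>\<gamma>\<close> comes from the step with index
    \<open>index \<gamma>\<close>. A splitting of \<open>x\<close> that nearly attains the meet
    \<open>M n x\<close> has less than \<open>e\<close> left over once \<open>M n b\<close> and
    \<open>M n c\<close> are subtracted, and the limits lie below these remainders.\<close>
  have sing: "\<exists>b\<in>carrier A. \<exists>c\<in>carrier A. padd A b c = Some x \<and> \<pi> b + \<rho> (act \<gamma> c) < e"
    if x: "x \<in> carrier A" and \<gamma>: "\<gamma> \<in> carrier \<Gamma>" and e: "0 < e" for x \<gamma> e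
  proof -
    define n where "n = index \<gamma>"
    have n: "enum n = \<gamma>" "n \<in> index ` carrier \<Gamma>"
      using \<gamma> by (auto simp: n_def enum_index)
    have Mn: "M n = meas_inf (P n) (\<lambda>a. Q n (act \<gamma> a))"
      using n by (simp add: M_def transfer_def)
    obtain b c where bc: "b \<in> carrier A" "c \<in> carrier A" "padd A b c = Some x"
      and less: "P n b + Q n (act \<gamma> c) < M n x + e"
      using meas_inf_approx[OF P[of n] finite_measure_act[OF \<gamma> Q[of n]] x, of "M n x + e"] e
      unfolding Mn by auto
    have "\<pi> b \<le> P n b - M n b"
      using \<pi>(2)[OF bc(1), of "Suc n"] by (simp add: step)
    moreover have "\<rho> (act \<gamma> c) \<le> Q n (act \<gamma> c) - M n c"
      using \<rho>(2)[OF act_closed[OF \<gamma> bc(2)], of "Suc n"]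
      by (simp add: step N_def act_measure_def n(1) act_inv_act[OF \<gamma> bc(2)])
    moreover have "M n x = M n b + M n c"
      by (rule finite_measure_padd[OF M bc])
    ultimately have "\<pi> b + \<rho> (act \<gamma> c) < e"
      using less by linarith
    then show ?thesis
      using bc by blast
  qed
  have \<pi>_zero: "\<pi> a = 0" if "a \<in> carrier A" for a
    using singular_imp_zero[OF joins \<pi>(1) \<rho>(1) agree' sing that] by blast
  \<comment> \<open>Here \<open>x\<close> is enlarged to an invariant element, where
    \<open>\<rho>\<close> equals \<open>\<pi>\<close> and hence is 0.\<close>
  have \<rho>_zero: "\<rho> x = 0" if x: "x \<in> carrier A" for x
  proof -
    obtain a where a: "gamma_invariant \<Gamma> act a" "a \<in> carrier A" "x \<preceq> a"
      using orbit_join_invariant[OF joins x] by blast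
    have "\<rho> x \<le> \<rho> a"
      by (rule finite_measure_mono[OF \<rho>(1) x a(3)])
    also have "\<rho> a = 0"
      using agree'[OF a(2,1)] \<pi>_zero[OF a(2)] by simp
    finally show ?thesis
      using finite_measure_nonneg[OF \<rho>(1) x] by simp
  qed
  have outside: "M n a = 0" "N n a = 0" if "n \<notin> index ` carrier \<Gamma>" for n a
    using that by (simp_all add: M_def N_def transfer_def act_measure_def)
  have "((\<lambda>\<gamma>. M (index \<gamma>) a) has_sum \<mu> a) (carrier \<Gamma>) \<and>
    ((\<lambda>\<gamma>. act_measure \<Gamma> act \<gamma> (M (index \<gamma>)) a) has_sum \<nu> a) (carrier \<Gamma>)" if a: "a \<in> carrier A" for a
  proof
    show "((\<lambda>\<gamma>. M (index \<gamma>) a) has_sum \<mu> a) (carrier \<Gamma>)"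
      by (rule has_sum_index[of "\<lambda>n. M n a"])
        (use \<pi>(3)[OF a] \<pi>_zero[OF a] finite_measure_nonneg[OF M a] outside in \<open>auto simp: zero\<close>)
    have "((\<lambda>\<gamma>. N (index \<gamma>) a) has_sum \<nu> a) (carrier \<Gamma>)"
      by (rule has_sum_index[of "\<lambda>n. N n a"])
        (use \<rho>(3)[OF a] \<rho>_zero[OF a] finite_measure_nonneg[OF N a] outside in \<open>auto simp: zero\<close>)
    moreover have "N (index \<gamma>) a = act_measure \<Gamma> act \<gamma> (M (index \<gamma>)) a" if "\<gamma> \<in> carrier \<Gamma>" for \<gamma>
      by (simp add: N_def enum_index[OF that])
    ultimately show "((\<lambda>\<gamma>. act_measure \<Gamma> act \<gamma> (M (index \<gamma>)) a) has_sum \<nu> a) (carrier \<Gamma>)"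
      by (simp cong: has_sum_cong)
  qed
  then show ?thesis
    unfolding equidecomposable_def using M by (intro exI[of _ "\<lambda>\<gamma>. M (index \<gamma>)"]) blast
qed

text \<open>At an invariant element the two sums agree term by term, and unordered sums are
  unique.\<close>

lemma equidecomposable_imp_invariant_agree:
  assumes "equidecomposable \<Gamma> A act \<mu> \<nu>" "a \<in> carrier A" "gamma_invariant \<Gamma> act a"
  shows "\<mu> a = \<nu> a"
proof -
  obtain m where m: "((\<lambda>\<gamma>. m \<gamma> a) has_sum \<mu> a) (carrier \<Gamma>)"
    "((\<lambda>\<gamma>. act_measure \<Gamma> act \<gamma> (m \<gamma>) a) has_sum \<nu> a) (carrier \<Gamma>)"
    using assms(1,2) unfolding equidecomposable_def by blast
  have "((\<lambda>\<gamma>. m \<gamma> a) has_sum \<nu> a) (carrier \<Gamma>)"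
    using m(2) act_measure_invariant[OF _ assms(3)] by (simp cong: has_sum_cong)
  then show ?thesis
    using has_sum_unique m(1) by blast
qed

end

theorem corollary1p2:
  fixes \<Gamma> :: "('g, 'k) monoid_scheme"
    and A :: "('a, 'm) gca_struct_scheme"
    and act :: "'g \<Rightarrow> 'a \<Rightarrow> 'a"
    and \<mu> \<nu> :: "'a \<Rightarrow> real"
  assumes "gamma_gca \<Gamma> A act"
    and "has_countable_joins A"
    and "finite_measure_on A \<mu>"
    and "finite_measure_on A \<nu>"
  shows "(\<forall>a\<in>carrier A. gamma_invariant \<Gamma> act a \<longrightarrow> \<mu> a = \<nu> a)
    \<longleftrightarrow> equidecomposable \<Gamma> A act \<mu> \<nu>"
  using gamma_gca.invariant_agree_imp_equidecomposable[OF assms]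
    gamma_gca.equidecomposable_imp_invariant_agree[OF assms(1)] by blast

end
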